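(* Let $n\ge1$, let $\lambda=(\lambda_1\ge\cdots\ge\lambda_n\ge0)$ be a partition (padded with zeros to length $n$), and set $A_{ij}=\lambda_i-\lambda_j+j-i$ for $1\le i<j\le n$. Then $$\sum_{k_1,\dots,k_n\ge0}\Big(\prod_{1\le i<j\le n}\frac{A_{ij}+k_i-k_j}{A_{ij}}\Big)\prod_{i=1}^n\frac{(-(i-1))_{k_i}}{(1)_{k_i}}=\frac{1}{|\mathrm{SST}(\lambda,n)|}=\prod_{1\le i<j\le n}\frac{j-i}{\lambda_i-\lambda_j+j-i},$$ i.e. $F^{(n)}\big((A_{ij})\,|\,(0,-1,\dots,-(n-1))^T\,|\,(1,\dots,1)^T\,|\,(1,\dots,1)^T\big)=1/|\mathrm{SST}(\lambda,n)|$.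
   Context: $(a)_0=1$, $(a)_m=a(a+1)\cdots(a+m-1)$; the sum is finite since $(-(i-1))_{k_i}=0$ for $k_i>i-1$. Holman's function $F^{(n)}\big((A_{ij})\,|\,(a_{i})\,|\,(b_{i})\,|\,(z_i)\big)=\sum_{k_1,\dots,k_n\ge0}\prod_{i<j}\frac{A_{ij}+k_i-k_j}{A_{ij}}\prod_{i}\frac{(a_i)_{k_i}}{(b_i)_{k_i}}z_i^{k_i}$. $\mathrm{SST}(\lambda,n)$ is the set of semistandard tableaux of shape $\lambda$ with entries in $\{1,\dots,n\}$ (rows weakly increasing, columns strictly increasing), whose cardinality is $\prod_{1\le i<j\le n}\frac{\lambda_i-\lambda_j+j-i}{j-i}$. *)

theory Defs
  imports "HOL-Analysis.Analysis"
begin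

definition yd_cells :: "(nat \<Rightarrow> nat) \<Rightarrow> nat \<Rightarrow> (nat \<times> nat) set" where
  "yd_cells lam n = {(r, c). 1 \<le> r \<and> r \<le> n \<and> 1 \<le> c \<and> c \<le> lam r}"

definition SST :: "(nat \<Rightarrow> nat) \<Rightarrow> nat \<Rightarrow> (nat \<times> nat \<Rightarrow> nat) set" where
  "SST lam n = {T.
     (\<forall>x. x \<notin> yd_cells lam n \<longrightarrow> T x = 0) \<and>
     (\<forall>x\<in>yd_cells lam n. T x \<in> {1..n}) \<and>
     (\<forall>r c. (r, c) \<in> yd_cells lam n \<and> (r, c + 1) \<in> yd_cells lam n \<longrightarrow> T (r, c) \<le> T (r, c + 1)) \<and>
     (\<forall>r c. (r, c) \<in> yd_cells lam n \<and> (r + 1, c) \<in> yd_cells lam n \<longrightarrow> T (r, c) < T (r + 1, c))}"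

definition Aij :: "(nat \<Rightarrow> nat) \<Rightarrow> nat \<Rightarrow> nat \<Rightarrow> real" where
  "Aij lam i j = real (lam i) - real (lam j) + real j - real i"

text \<open>Summand of Holman's series with a_i = -(i-1), b_i = 1, z_i = 1.\<close>
definition holman_term :: "(nat \<Rightarrow> nat) \<Rightarrow> nat \<Rightarrow> (nat \<Rightarrow> nat) \<Rightarrow> real" where
  "holman_term lam n k =
     (\<Prod>(i, j)\<in>{(i, j). 1 \<le> i \<and> i < j \<and> j \<le> n}.
        (Aij lam i j + real (k i) - real (k j)) / Aij lam i j) *
     (\<Prod>i\<in>{1..n}. pochhammer (- real (i - 1)) (k i) / pochhammer 1 (k i))"

end

theory Submission
  imports Defs "Jordan_Normal_Form.Determinant"
begin

text \<open>
  Put \<open>x\<^sub>i = i - \<lambda>\<^sub>i\<close>, so that \<open>A\<^sub>i\<^sub>j = x\<^sub>j - x\<^sub>i\<close>. In the basis of binomial polynomials the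
  Vandermonde product becomes \<open>D\<^sub>n(x) = det (x\<^sub>i choose j) = \<Prod>\<^sub>i\<^sub><\<^sub>j (x\<^sub>j - x\<^sub>i) / (j - i)\<close>, with
  columns \<open>j = 0, \<dots>, n - 1\<close>. Both halves follow from row multilinearity of this determinant.
  The Holman weights are \<open>(-1)\<^sup>k (i - 1 choose k)\<close>, so summing over \<open>k\<^sub>i\<close> takes the backward
  difference of order \<open>i - 1\<close> of row \<open>i\<close>; the result is upper unitriangular and the weighted sum of
  \<open>D\<^sub>n(x - k)\<close> equals 1. Removing the entries \<open>n + 1\<close> from a tableau gives a sum over interlacing
  shapes, which on the determinant side telescopes to the differences of consecutive rows, so
  \<open>D\<^sub>n(x)\<close> counts the tableaux.
\<close>

section \<open>Determinants summed over boxes\<close>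

text \<open>Unlike in \<open>PiE\<close>, the default off \<open>I\<close> is 0 instead of
  \<open>undefined\<close>. The boxes are thereby subsets of the index set of the series, and an
  interlacing shape is a row-length function that vanishes beyond row \<open>n\<close>.\<close>

definition supported_box :: "'a set \<Rightarrow> ('a \<Rightarrow> nat set) \<Rightarrow> ('a \<Rightarrow> nat) set" where
  "supported_box I K = {k. (\<forall>i\<in>I. k i \<in> K i) \<and> (\<forall>i. i \<notin> I \<longrightarrow> k i = 0)}"

lemma bij_betw_supported_box_PiE:
  "bij_betw (\<lambda>k. restrict k I) (supported_box I K) (PiE I K)"
  by (rule bij_betw_byWitness[where f' = "\<lambda>k i. if i \<in> I then k i else 0"])
     (auto simp: supported_box_def fun_eq_iff PiE_def extensional_def)

lemma finite_supported_box:
  assumes "finite I" "\<And>i. i \<in> I \<Longrightarrow> finite (K i)"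
  shows "finite (supported_box I K)"
  using bij_betw_finite[OF bij_betw_supported_box_PiE, of I K] finite_PiE[of I K] assms by blast

lemma sum_supported_box_prod:
  fixes f :: "'a \<Rightarrow> nat \<Rightarrow> 'b :: comm_semiring_1"
  assumes "finite I" "\<And>i. i \<in> I \<Longrightarrow> finite (K i)"
  shows "(\<Sum>k\<in>supported_box I K. \<Prod>i\<in>I. f i (k i)) = (\<Prod>i\<in>I. \<Sum>k\<in>K i. f i k)"
proof -
  have "(\<Sum>k\<in>supported_box I K. \<Prod>i\<in>I. f i (k i))
      = (\<Sum>k\<in>supported_box I K. \<Prod>i\<in>I. f i (restrict k I i))"
    by simp
  also have "\<dots> = (\<Sum>k\<in>PiE I K. \<Prod>i\<in>I. f i (k i))"
    by (rule sum.reindex_bij_betw[OF bij_betw_supported_box_PiE])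
  finally show ?thesis
    using prod_sum_PiE[of I K f] assms by simp
qed

lemma det_mat_Leibniz:
  "Determinant.det (Matrix.mat n n (\<lambda>(i, j). f i j))
     = (\<Sum>p | p permutes {0..<n}. signof p * (\<Prod>i = 0..<n. f i (p i)))"
proof -
  have "p i < n" if "p permutes {0..<n}" "i < n" for p i
    using permutes_in_image[OF that(1), of i] that(2) by simp
  then show ?thesis
    by (subst det_def'[of _ n]) (auto intro!: sum.cong prod.cong)
qed

text \<open>Multilinearity in the rows: row \<open>i\<close> depends on the single coordinate
  \<open>k i\<close>, so each Leibniz term is a product over independent coordinates and its sum
  over the box factorises.\<close>

lemma sum_supported_box_det:
  fixes F :: "nat \<Rightarrow> nat \<Rightarrow> nat \<Rightarrow> real"
  assumes "\<And>i. i \<in> {1..n} \<Longrightarrow> finite (K i)"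
  shows "(\<Sum>k\<in>supported_box {1..n} K.
            Determinant.det (Matrix.mat n n (\<lambda>(i, j). F (Suc i) (k (Suc i)) j)))
       = Determinant.det (Matrix.mat n n (\<lambda>(i, j). \<Sum>k\<in>K (Suc i). F (Suc i) k j))"
proof -
  \<comment> \<open>Matrix rows count from 0, box coordinates from 1.\<close>
  have shift: "(\<Prod>i = 0..<n. g (Suc i) (p i)) = (\<Prod>i\<in>{1..n}. g i (p (i - 1)))"
    for g :: "nat \<Rightarrow> nat \<Rightarrow> real" and p
    by (rule prod.reindex_bij_witness[of _ "\<lambda>i. i - 1" Suc]) auto
  have "(\<Sum>k\<in>supported_box {1..n} K.
            Determinant.det (Matrix.mat n n (\<lambda>(i, j). F (Suc i) (k (Suc i)) j)))
      = (\<Sum>k\<in>supported_box {1..n} K. \<Sum>p | p permutes {0..<n}.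
            signof p * (\<Prod>i = 0..<n. F (Suc i) (k (Suc i)) (p i)))"
    by (intro sum.cong refl) (simp add: det_mat_Leibniz cong: prod.cong)
  also have "\<dots> = (\<Sum>k\<in>supported_box {1..n} K. \<Sum>p | p permutes {0..<n}.
            signof p * (\<Prod>i\<in>{1..n}. F i (k i) (p (i - 1))))"
    using shift[of "\<lambda>i. F i (k i)" for k] by simp
  also have "\<dots> = (\<Sum>p | p permutes {0..<n}. signof p *
            (\<Sum>k\<in>supported_box {1..n} K. \<Prod>i\<in>{1..n}. F i (k i) (p (i - 1))))"
    by (subst sum.swap) (simp add: sum_distrib_left)
  also have "\<dots> = (\<Sum>p | p permutes {0..<n}. signof p *
            (\<Prod>i\<in>{1..n}. \<Sum>k\<in>K i. F i k (p (i - 1))))"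
    by (subst sum_supported_box_prod) (use assms in auto)
  also have "\<dots> = (\<Sum>p | p permutes {0..<n}. signof p *
            (\<Prod>i = 0..<n. \<Sum>k\<in>K (Suc i). F (Suc i) k (p i)))"
    using shift[of "\<lambda>i j. \<Sum>k\<in>K i. F i k j"] by simp
  also have "\<dots> = Determinant.det (Matrix.mat n n (\<lambda>(i, j). \<Sum>k\<in>K (Suc i). F (Suc i) k j))"
    by (simp add: det_mat_Leibniz cong: prod.cong)
  finally show ?thesis .
qed

section \<open>Scaling and expansion of determinants\<close>

lemma det_scale_rows_cols:
  fixes c d :: "nat \<Rightarrow> real"
  shows "Determinant.det (Matrix.mat n n (\<lambda>(i, j). c i * d j * f i j))
       = (\<Prod>i<n. c i) * (\<Prod>j<n. d j) * Determinant.det (Matrix.mat n n (\<lambda>(i, j). f i j))"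
proof -
  \<comment> \<open>A permutation merely rearranges the column factors, so they leave the Leibniz
    sum as a common factor.\<close>
  have "(\<Prod>i = 0..<n. d (p i)) = (\<Prod>j = 0..<n. d j)" if "p permutes {0..<n}" for p
    using prod.permute[OF that, of d] by (simp add: o_def)
  then show ?thesis
    by (auto simp: det_mat_Leibniz prod.distrib sum_distrib_left lessThan_atLeast0 mult_ac
          cong: prod.cong intro!: sum.cong)
qed

lemma det_expand_unit_row:
  fixes f :: "nat \<Rightarrow> nat \<Rightarrow> real"
  assumes "f 0 0 = 1" "\<And>j. 0 < j \<Longrightarrow> j \<le> n \<Longrightarrow> f 0 j = 0"
  shows "Determinant.det (Matrix.mat (Suc n) (Suc n) (\<lambda>(i, j). f i j))
       = Determinant.det (Matrix.mat n n (\<lambda>(i, j). f (Suc i) (Suc j)))"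
proof -
  let ?A = "Matrix.mat (Suc n) (Suc n) (\<lambda>(i, j). f i j)"
  have "Determinant.det ?A = (\<Sum>j<Suc n. ?A $$ (0, j) * cofactor ?A 0 j)"
    by (rule laplace_expansion_row) auto
  also have "\<dots> = cofactor ?A 0 0"
    using assms by (simp add: sum.lessThan_Suc_shift del: sum.lessThan_Suc)
  also have "mat_delete ?A 0 0 = Matrix.mat n n (\<lambda>(i, j). f (Suc i) (Suc j))"
    by (rule eq_matI) (auto simp: mat_delete_def)
  then have "cofactor ?A 0 0 = Determinant.det (Matrix.mat n n (\<lambda>(i, j). f (Suc i) (Suc j)))"
    by (simp add: cofactor_def)
  finally show ?thesis .
qed

lemma det_expand_unit_column:
  fixes f :: "nat \<Rightarrow> nat \<Rightarrow> real"
  assumes "f 0 0 = 1" "\<And>i. 0 < i \<Longrightarrow> i \<le> n \<Longrightarrow> f i 0 = 0"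
  shows "Determinant.det (Matrix.mat (Suc n) (Suc n) (\<lambda>(i, j). f i j))
       = Determinant.det (Matrix.mat n n (\<lambda>(i, j). f (Suc i) (Suc j)))"
proof -
  have transp: "Determinant.det (Matrix.mat m m (\<lambda>(i, j). g j i))
      = Determinant.det (Matrix.mat m m (\<lambda>(i, j). g i j))" for m and g :: "nat \<Rightarrow> nat \<Rightarrow> real"
  proof -
    have "transpose_mat (Matrix.mat m m (\<lambda>(i, j). g i j)) = Matrix.mat m m (\<lambda>(i, j). g j i)"
      by (rule eq_matI) auto
    then show ?thesis
      using det_transpose[of "Matrix.mat m m (\<lambda>(i, j). g i j)" m] by simp
  qed
  show ?thesis
    using det_expand_unit_row[of "\<lambda>i j. f j i" n] assms
    by (simp add: transp[of _ f] transp[of _ "\<lambda>i j. f (Suc i) (Suc j)"])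
qed

section \<open>The binomial Vandermonde determinant\<close>

text \<open>The argument \<open>x\<close> is indexed from 1, the rows and columns of the matrix from 0.\<close>

definition binomial_det :: "nat \<Rightarrow> (nat \<Rightarrow> real) \<Rightarrow> real" where
  "binomial_det n x = Determinant.det (Matrix.mat n n (\<lambda>(i, j). x (Suc i) gchoose j))"

lemma gbinomial_Suc_mult: "(a gchoose Suc k) = (a - real k) / real (Suc k) * (a gchoose k)"
  for a :: real
  using gbinomial_absorb_comp[of a k] gbinomial_absorption[of k a]
  by (simp add: field_simps del: of_nat_Suc)

text \<open>The Vandermonde recursion: once column operations have cleared the first row, each
  remaining row has a factor \<open>x (Suc j) - x 1\<close> and each remaining column a factor
  \<open>1 / j\<close>. Pulling these out leaves the same determinant for the shifted
  argument.\<close>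

lemma binomial_det_Suc:
  "binomial_det (Suc n) x
     = (\<Prod>j\<in>{1..n}. (x (Suc j) - x 1) / real j) * binomial_det n (\<lambda>i. x (Suc i))"
proof -
  define A where "A = Matrix.mat (Suc n) (Suc n) (\<lambda>(i, j). x (Suc i) gchoose j)"
  \<comment> \<open>Subtracting \<open>(x\<^sub>1 - j + 1) / j\<close> times column \<open>j - 1\<close> from column \<open>j\<close> clears the first row.\<close>
  define U where "U = Matrix.mat (Suc n) (Suc n)
     (\<lambda>(k, j). if k = j then 1 else if Suc k = j then - (x 1 - real k) / real j else 0)"
  \<comment> \<open>The entries of \<open>A * U\<close>. With \<open>m = j - 1\<close> and
    \<open>a = x (Suc i)\<close>, the factor of \<open>a gchoose m\<close> is
    \<open>(a - m) / j - (x 1 - m) / j = (a - x 1) / j\<close>, which vanishes in row 0.\<close>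
  define f where "f = (\<lambda>i j. if j = 0 then 1
     else (x (Suc i) - x 1) * (1 / real j) * (x (Suc i) gchoose (j - 1)))"
  have carrier: "A \<in> carrier_mat (Suc n) (Suc n)" "U \<in> carrier_mat (Suc n) (Suc n)"
    by (simp_all add: A_def U_def)
  have "Determinant.det U = prod_list (diag_mat U)"
    by (rule det_upper_triangular[OF _ carrier(2)]) (auto simp: U_def)
  then have det_U: "Determinant.det U = 1"
    by (simp add: prod_list_diag_prod U_def)
  have "A * U = Matrix.mat (Suc n) (Suc n) (\<lambda>(i, j). f i j)"
  proof (rule eq_matI)
    fix i j assume "i < dim_row (Matrix.mat (Suc n) (Suc n) (\<lambda>(i, j). f i j))"
      "j < dim_col (Matrix.mat (Suc n) (Suc n) (\<lambda>(i, j). f i j))"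
    then have ij: "i < Suc n" "j < Suc n" by simp_all
    have "(A * U) $$ (i, j) = (\<Sum>k<Suc n. A $$ (i, k) * U $$ (k, j))"
      using ij by (simp add: A_def U_def scalar_prod_def lessThan_atLeast0)
    also have "\<dots> = (\<Sum>k<Suc n. (x (Suc i) gchoose k) *
        (if k = j then 1 else if Suc k = j then - (x 1 - real k) / real j else 0))"
      using ij by (intro sum.cong) (auto simp: A_def U_def)
    also have "\<dots> = f i j"
    proof (cases j)
      case 0
      then show ?thesis
        by (simp add: f_def if_distrib[of "\<lambda>t. _ * t"] cong: if_cong del: sum.lessThan_Suc)
    next
      case (Suc m)
      \<comment> \<open>Column \<open>j\<close> of \<open>U\<close> has nonzero entries at most at
        \<open>k = j\<close> and \<open>k = m = j - 1\<close>.\<close>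
      have "(\<Sum>k<Suc n. (x (Suc i) gchoose k) *
        (if k = j then 1 else if Suc k = j then - (x 1 - real k) / real j else 0))
        = (\<Sum>k<Suc n. (if k = j then x (Suc i) gchoose j else 0)
           + (if k = m then (x (Suc i) gchoose m) * (- (x 1 - real m) / real j) else 0))"
        by (intro sum.cong) (auto simp: Suc)
      also have "\<dots> = (x (Suc i) gchoose j) + (x (Suc i) gchoose m) * (- (x 1 - real m) / real j)"
        using ij Suc by (simp add: sum.distrib del: sum.lessThan_Suc)
      also have "\<dots> = f i j"
        by (simp add: Suc f_def gbinomial_Suc_mult field_simps del: of_nat_Suc)
      finally show ?thesis .
    qed
    finally show "(A * U) $$ (i, j) = Matrix.mat (Suc n) (Suc n) (\<lambda>(i, j). f i j) $$ (i, j)"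
      using ij by simp
  qed (simp_all add: A_def U_def)
  then have "binomial_det (Suc n) x = Determinant.det (Matrix.mat (Suc n) (Suc n) (\<lambda>(i, j). f i j))"
    using det_mult[OF carrier] det_U by (simp add: binomial_det_def A_def)
  also have "\<dots> = Determinant.det (Matrix.mat n n (\<lambda>(i, j). f (Suc i) (Suc j)))"
    by (rule det_expand_unit_row) (auto simp: f_def)
  also have "\<dots> = Determinant.det (Matrix.mat n n (\<lambda>(i, j).
      (x (Suc (Suc i)) - x 1) * (1 / real (Suc j)) * (x (Suc (Suc i)) gchoose j)))"
    by (simp add: f_def)
  also have "\<dots> = (\<Prod>i<n. x (Suc (Suc i)) - x 1) * (\<Prod>j<n. 1 / real (Suc j))
      * binomial_det n (\<lambda>i. x (Suc i))"
    unfolding binomial_det_def by (rule det_scale_rows_cols)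
  also have "(\<Prod>i<n. x (Suc (Suc i)) - x 1) * (\<Prod>j<n. 1 / real (Suc j))
      = (\<Prod>j<n. (x (Suc (Suc j)) - x 1) / real (Suc j))"
    by (simp flip: prod.distrib)
  also have "\<dots> = (\<Prod>j\<in>{1..n}. (x (Suc j) - x 1) / real j)"
    by (rule prod.reindex_bij_witness[of _ "\<lambda>i. i - 1" Suc]) auto
  finally show ?thesis .
qed

text \<open>The pairs with first component 1 yield the factor split off in
  \<open>binomial_det_Suc\<close>. All others come from pairs for \<open>n\<close> by raising both
  indices, which preserves \<open>j - i\<close>.\<close>

lemma prod_pairs_Suc:
  fixes f :: "nat \<Rightarrow> nat \<Rightarrow> 'a :: comm_monoid_mult"
  shows "(\<Prod>(i, j)\<in>{(i, j). 1 \<le> i \<and> i < j \<and> j \<le> Suc n}. f i j)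
       = (\<Prod>j\<in>{1..n}. f 1 (Suc j)) * (\<Prod>(i, j)\<in>{(i, j). 1 \<le> i \<and> i < j \<and> j \<le> n}. f (Suc i) (Suc j))"
proof -
  let ?P = "\<lambda>n. {(i, j). 1 \<le> i \<and> i < j \<and> j \<le> n} :: (nat \<times> nat) set"
  have fin: "finite (?P n)"
    by (rule finite_subset[of _ "{..n} \<times> {..n}"]) auto
  have split: "?P (Suc n) = (\<lambda>j. (1, Suc j)) ` {1..n} \<union> (\<lambda>(i, j). (Suc i, Suc j)) ` ?P n"
  proof (intro equalityI subsetI)
    fix p assume p: "p \<in> ?P (Suc n)"
    obtain i j where ij: "p = (i, j)" by (cases p)
    show "p \<in> (\<lambda>j. (1, Suc j)) ` {1..n} \<union> (\<lambda>(i, j). (Suc i, Suc j)) ` ?P n"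
    proof (cases "i = 1")
      case True
      then show ?thesis using p ij by (auto intro!: image_eqI[of _ _ "j - 1"])
    next
      case False
      then have "p \<in> (\<lambda>(i, j). (Suc i, Suc j)) ` ?P n"
        using p ij by (intro image_eqI[of _ _ "(i - 1, j - 1)"]) auto
      then show ?thesis by blast
    qed
  qed auto
  have "(\<Prod>(i, j)\<in>?P (Suc n). f i j) = (\<Prod>(i, j)\<in>(\<lambda>j. (1, Suc j)) ` {1..n}. f i j)
      * (\<Prod>(i, j)\<in>(\<lambda>(i, j). (Suc i, Suc j)) ` ?P n. f i j)"
    unfolding split by (rule prod.union_disjoint) (use fin in auto)
  also have "(\<Prod>(i, j)\<in>(\<lambda>j. (1, Suc j)) ` {1..n}. f i j) = (\<Prod>j\<in>{1..n}. f 1 (Suc j))"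
    by (subst prod.reindex) (auto simp: inj_on_def)
  also have "(\<Prod>(i, j)\<in>(\<lambda>(i, j). (Suc i, Suc j)) ` ?P n. f i j)
      = (\<Prod>(i, j)\<in>?P n. f (Suc i) (Suc j))"
    by (subst prod.reindex) (auto simp: inj_on_def intro!: prod.cong)
  finally show ?thesis .
qed

lemma binomial_det_eq_prod:
  "binomial_det n x
     = (\<Prod>(i, j)\<in>{(i, j). 1 \<le> i \<and> i < j \<and> j \<le> n}. (x j - x i) / real (j - i))"
proof (induction n arbitrary: x)
  case 0
  show ?case
    by (subst prod.neutral) (auto simp: binomial_det_def)
next
  case (Suc n)
  show ?case
    unfolding binomial_det_Suc Suc.IH prod_pairs_Suc by simp
qed

section \<open>Interlacing sums of binomial determinants\<close>

lemma binomial_det_Suc_differences: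
  "binomial_det (Suc n) x = Determinant.det (Matrix.mat n n
     (\<lambda>(i, j). (x (Suc (Suc i)) gchoose Suc j) - (x (Suc i) gchoose Suc j)))"
proof -
  define A where "A = Matrix.mat (Suc n) (Suc n) (\<lambda>(i, j). x (Suc i) gchoose j)"
  \<comment> \<open>\<open>L\<close> subtracts from each row its predecessor. Column 0 of
    \<open>A\<close> is constantly 1, so it turns into a unit vector along which the determinant
    expands.\<close>
  define L where "L = Matrix.mat (Suc n) (Suc n)
     (\<lambda>(i, k). if k = i then 1 else if i = Suc k then - 1 else 0 :: real)"
  define f where "f = (\<lambda>i j. if i = 0 then x 1 gchoose j
     else (x (Suc i) gchoose j) - (x i gchoose j))"
  have carrier: "L \<in> carrier_mat (Suc n) (Suc n)" "A \<in> carrier_mat (Suc n) (Suc n)"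
    by (simp_all add: A_def L_def)
  have "Determinant.det L = prod_list (diag_mat L)"
    by (rule det_lower_triangular[OF _ carrier(1)]) (auto simp: L_def)
  then have det_L: "Determinant.det L = 1"
    by (simp add: prod_list_diag_prod L_def)
  have "L * A = Matrix.mat (Suc n) (Suc n) (\<lambda>(i, j). f i j)"
  proof (rule eq_matI)
    fix i j assume "i < dim_row (Matrix.mat (Suc n) (Suc n) (\<lambda>(i, j). f i j))"
      "j < dim_col (Matrix.mat (Suc n) (Suc n) (\<lambda>(i, j). f i j))"
    then have ij: "i < Suc n" "j < Suc n" by simp_all
    have "(L * A) $$ (i, j) = (\<Sum>k<Suc n. L $$ (i, k) * A $$ (k, j))"
      using ij by (simp add: A_def L_def scalar_prod_def lessThan_atLeast0)
    also have "\<dots> = (\<Sum>k<Suc n. (if k = i then x (Suc k) gchoose j else 0)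
        - (if i = Suc k then x (Suc k) gchoose j else 0))"
      using ij by (intro sum.cong) (auto simp: A_def L_def)
    also have "\<dots> = f i j"
    proof (cases i)
      case 0
      then show ?thesis
        by (simp add: f_def sum_subtractf del: sum.lessThan_Suc)
    next
      case (Suc m)
      then show ?thesis
        using ij by (simp add: f_def sum_subtractf del: sum.lessThan_Suc)
    qed
    finally show "(L * A) $$ (i, j) = Matrix.mat (Suc n) (Suc n) (\<lambda>(i, j). f i j) $$ (i, j)"
      using ij by simp
  qed (simp_all add: A_def L_def)
  then have "binomial_det (Suc n) x = Determinant.det (Matrix.mat (Suc n) (Suc n) (\<lambda>(i, j). f i j))"
    using det_mult[OF carrier] det_L by (simp add: binomial_det_def A_def)
  also have "\<dots> = Determinant.det (Matrix.mat n n (\<lambda>(i, j). f (Suc i) (Suc j)))"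
    by (rule det_expand_unit_column) (auto simp: f_def)
  finally show ?thesis
    by (simp add: f_def)
qed

text \<open>By Pascal's rule each summand is
  \<open>((a + 1 - m) gchoose Suc j) - ((a - m) gchoose Suc j)\<close>, and the sum
  telescopes.\<close>

lemma sum_gbinomial_interval:
  fixes a :: real
  assumes "p \<le> q"
  shows "(\<Sum>m = p..q. (a - real m) gchoose j)
       = ((a + 1 - real p) gchoose Suc j) - ((a - real q) gchoose Suc j)"
  using assms
proof (induction q rule: dec_induct)
  case base
  then show ?case
    using gbinomial_Suc_Suc[of "a - real p" j] by (simp add: algebra_simps)
next
  case (step q)
  then show ?case
    using gbinomial_Suc_Suc[of "a - real (Suc q)" j] by (simp add: algebra_simps)
qed

text \<open>Multilinearity lets every row be summed separately. With \<open>a = i\<close> the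
  telescoped sum ends at \<open>i + 1 - lam (Suc i)\<close> and \<open>i - lam i\<close>, the
  arguments of two consecutive rows, which is the matrix of row differences.\<close>

lemma binomial_det_interlacing:
  assumes "\<And>i. 1 \<le> i \<Longrightarrow> i \<le> n \<Longrightarrow> lam (Suc i) \<le> lam i"
  shows "binomial_det (Suc n) (\<lambda>i. real i - real (lam i))
       = (\<Sum>mu\<in>supported_box {1..n} (\<lambda>i. {lam (Suc i)..lam i}).
            binomial_det n (\<lambda>i. real i - real (mu i)))"
proof -
  have "(\<Sum>mu\<in>supported_box {1..n} (\<lambda>i. {lam (Suc i)..lam i}).
            binomial_det n (\<lambda>i. real i - real (mu i)))
      = Determinant.det (Matrix.mat n n (\<lambda>(i, j).
          \<Sum>m = lam (Suc (Suc i))..lam (Suc i). (real (Suc i) - real m) gchoose j))"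
    unfolding binomial_det_def
    using sum_supported_box_det[of n "\<lambda>i. {lam (Suc i)..lam i}" "\<lambda>i m j. (real i - real m) gchoose j"]
    by simp
  also have "\<dots> = binomial_det (Suc n) (\<lambda>i. real i - real (lam i))"
    unfolding binomial_det_Suc_differences
    by (intro arg_cong[of _ _ Determinant.det] eq_matI)
       (auto simp: sum_gbinomial_interval assms algebra_simps)
  finally show ?thesis by simp
qed

section \<open>Backward differences\<close>

text \<open>Pascal's rule for the coefficients: a difference of order \<open>Suc m\<close> is the
  difference of order \<open>m\<close> of the first differences.\<close>

lemma sum_alternating_binomial_Suc:
  fixes f :: "nat \<Rightarrow> real"
  shows "(\<Sum>k\<le>Suc m. (- 1) ^ k * real (Suc m choose k) * f k)
       = (\<Sum>k\<le>m. (- 1) ^ k * real (m choose k) * (f k - f (Suc k)))"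
proof -
  have "(\<Sum>k\<le>Suc m. (- 1) ^ k * real (Suc m choose k) * f k)
      = f 0 - (\<Sum>k\<le>m. (- 1) ^ k * real (m choose k) * f (Suc k))
        + (\<Sum>k\<le>m. (- 1) ^ Suc k * real (m choose Suc k) * f (Suc k))"
    by (simp add: sum.atMost_Suc_shift sum.distrib sum_negf sum_subtractf algebra_simps del: sum.atMost_Suc)
  \<comment> \<open>Shifting the index back absorbs \<open>f 0\<close>; the top term has coefficient
    \<open>m choose Suc m = 0\<close> and drops out afterwards.\<close>
  also have "f 0 + (\<Sum>k\<le>m. (- 1) ^ Suc k * real (m choose Suc k) * f (Suc k))
      = (\<Sum>k\<le>Suc m. (- 1) ^ k * real (m choose k) * f k)"
    by (simp add: sum.atMost_Suc_shift del: sum.atMost_Suc)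
  then have "f 0 - (\<Sum>k\<le>m. (- 1) ^ k * real (m choose k) * f (Suc k))
        + (\<Sum>k\<le>m. (- 1) ^ Suc k * real (m choose Suc k) * f (Suc k))
      = (\<Sum>k\<le>m. (- 1) ^ k * real (m choose k) * f k)
        - (\<Sum>k\<le>m. (- 1) ^ k * real (m choose k) * f (Suc k))"
    by simp
  finally show ?thesis
    by (simp add: sum_subtractf right_diff_distrib)
qed

text \<open>One backward difference lowers both the argument and the lower index of
  \<open>a gchoose j\<close> by 1, and annihilates the constant case \<open>j = 0\<close>.\<close>

lemma sum_backward_difference_gbinomial:
  fixes a :: real
  shows "(\<Sum>k\<le>m. (- 1) ^ k * real (m choose k) * ((a - real k) gchoose j))
       = (if j < m then 0 else (a - real m) gchoose (j - m))"
proof (induction m arbitrary: a j)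
  case 0
  then show ?case by simp
next
  case (Suc m)
  show ?case
  proof (cases j)
    case 0
    then show ?thesis
      by (subst sum_alternating_binomial_Suc) simp
  next
    case (Suc l)
    have "((a - real k) gchoose j) - ((a - real (Suc k)) gchoose j) = (a - 1 - real k) gchoose l" for k
      using gbinomial_Suc_Suc[of "a - 1 - real k" l] by (simp add: Suc algebra_simps)
    then show ?thesis
      using Suc.IH[of "a - 1" l] by (subst sum_alternating_binomial_Suc) (simp add: Suc algebra_simps)
  qed
qed

lemma pochhammer_minus_nat_ratio:
  "pochhammer (- real m) k / pochhammer 1 k = (- 1) ^ k * real (m choose k)"
  by (simp add: binomial_gbinomial gbinomial_pochhammer flip: pochhammer_fact mult.assoc power_add)

lemma sum_holman_binomial_det:
  "(\<Sum>k\<in>supported_box {1..n} (\<lambda>i. {..i - 1}).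
      (\<Prod>i\<in>{1..n}. pochhammer (- real (i - 1)) (k i) / pochhammer 1 (k i))
        * binomial_det n (\<lambda>i. x i - real (k i))) = 1"
proof -
  define w :: "nat \<Rightarrow> nat \<Rightarrow> real" where "w = (\<lambda>i k. (- 1) ^ k * real ((i - 1) choose k))"
  define M where "M = Matrix.mat n n
    (\<lambda>(i, j). \<Sum>k\<le>i. w (Suc i) k * ((x (Suc i) - real k) gchoose j))"
  have dim: "dim_row M = n" "dim_col M = n"
    by (simp_all add: M_def)
  \<comment> \<open>Row \<open>i\<close>, counted from 0, carries the difference of order
    \<open>i\<close>. The entries vanish below the diagonal and are \<open>_ gchoose 0 = 1\<close>
    on it, whatever \<open>x\<close> is.\<close>
  have entry: "M $$ (i, j) = (if j < i then 0 else (x (Suc i) - real i) gchoose (j - i))"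
    if "i < n" "j < n" for i j
    using that sum_backward_difference_gbinomial[of i "x (Suc i)" j] by (simp add: M_def w_def)
  \<comment> \<open>Each weight is absorbed into its own row, with trivial column factors, so that
    the box sum can act row by row.\<close>
  have rows: "(\<Prod>i\<in>{1..n}. w i (k i)) * binomial_det n (\<lambda>i. x i - real (k i))
      = Determinant.det (Matrix.mat n n
          (\<lambda>(i, j). w (Suc i) (k (Suc i)) * ((x (Suc i) - real (k (Suc i))) gchoose j)))" for k
  proof -
    have "(\<Prod>i\<in>{1..n}. w i (k i)) = (\<Prod>i<n. w (Suc i) (k (Suc i)))"
      by (rule prod.reindex_bij_witness[of _ Suc "\<lambda>i. i - 1"]) auto
    then show ?thesis
      using det_scale_rows_cols[of n "\<lambda>i. w (Suc i) (k (Suc i))" "\<lambda>_. 1"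
        "\<lambda>i j. (x (Suc i) - real (k (Suc i))) gchoose j"]
      by (simp add: binomial_det_def)
  qed
  have "(\<Sum>k\<in>supported_box {1..n} (\<lambda>i. {..i - 1}).
      (\<Prod>i\<in>{1..n}. pochhammer (- real (i - 1)) (k i) / pochhammer 1 (k i))
        * binomial_det n (\<lambda>i. x i - real (k i)))
     = (\<Sum>k\<in>supported_box {1..n} (\<lambda>i. {..i - 1}).
      (\<Prod>i\<in>{1..n}. w i (k i)) * binomial_det n (\<lambda>i. x i - real (k i)))"
    unfolding pochhammer_minus_nat_ratio w_def ..
  also have "\<dots> = Determinant.det M"
    unfolding rows M_def
    using sum_supported_box_det[of n "\<lambda>i. {..i - 1}" "\<lambda>i k j. w i k * ((x i - real k) gchoose j)"]
    by simp
  also have "\<dots> = prod_list (diag_mat M)"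
    by (rule det_upper_triangular[of _ n]) (use dim in \<open>auto simp: entry\<close>)
  also have "\<dots> = 1"
    by (simp add: prod_list_diag_prod dim entry)
  finally show ?thesis .
qed

section \<open>Branching of semistandard tableaux\<close>

text \<open>The inverse of deleting all entries \<open>Suc n\<close> from a tableau of shape
  \<open>lam\<close>.\<close>

definition extend_tableau ::
  "(nat \<Rightarrow> nat) \<Rightarrow> nat \<Rightarrow> (nat \<Rightarrow> nat) \<Rightarrow> (nat \<times> nat \<Rightarrow> nat) \<Rightarrow> nat \<times> nat \<Rightarrow> nat" where
  "extend_tableau lam n mu T = (\<lambda>x. if x \<in> yd_cells mu n then T x
     else if x \<in> yd_cells lam (Suc n) then Suc n else 0)"

text \<open>Meant for a tableau row with \<open>P c\<close> saying that the entry in column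
  \<open>c\<close> is at most \<open>n\<close>; \<open>m\<close> is then the length of that row
  after deletion of the entries \<open>Suc n\<close>.\<close>

lemma downclosed_initial_segment:
  fixes L :: nat
  assumes "\<And>c. 1 \<le> c \<Longrightarrow> c < L \<Longrightarrow> P (Suc c) \<Longrightarrow> P c"
  shows "\<exists>m\<le>L. \<forall>c. 1 \<le> c \<and> c \<le> L \<longrightarrow> (P c \<longleftrightarrow> c \<le> m)"
  using assms
proof (induction L)
  case 0
  then show ?case by simp
next
  case (Suc L)
  obtain m where m: "m \<le> L" "\<And>c. 1 \<le> c \<Longrightarrow> c \<le> L \<Longrightarrow> P c \<longleftrightarrow> c \<le> m"
    using Suc.IH Suc.prems by (metis less_Suc_eq)
  show ?case
  proof (cases "P (Suc L)")
    case True
    then have "m = L"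
      using m(2)[of L] m(1) Suc.prems[of L] by (cases "L = 0") auto
    then show ?thesis
      using True m by (intro exI[of _ "Suc L"]) (auto simp: le_Suc_eq)
  next
    case False
    then show ?thesis
      using m by (intro exI[of _ m]) (auto simp: le_Suc_eq)
  qed
qed

text \<open>Columns start in row 1 with an entry at least 1 and increase strictly; monotonicity of
  \<open>lam\<close> supplies the cell above. In the last row this forces every entry to be
  maximal.\<close>

lemma SST_entry_ge_row:
  assumes T: "T \<in> SST lam n" and dec: "\<And>i. 1 \<le> i \<Longrightarrow> i < n \<Longrightarrow> lam (Suc i) \<le> lam i"
    and "(r, c) \<in> yd_cells lam n"
  shows "r \<le> T (r, c)"
  using assms(3)
proof (induction r)
  case 0
  then show ?case by simp
next
  case (Suc r)
  show ?case
  proof (cases "r = 0")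
    case True
    then show ?thesis
      using T Suc.prems by (auto simp: SST_def)
  next
    case False
    then have cell: "(r, c) \<in> yd_cells lam n"
      using Suc.prems dec[of r] by (auto simp: yd_cells_def)
    moreover have "T (r, c) < T (Suc r, c)"
      using T cell Suc.prems by (simp add: SST_def)
    ultimately show ?thesis
      using Suc.IH by simp
  qed
qed

text \<open>The two interlacing bounds do separate work: \<open>mu r <= lam r\<close> places the old
  cells inside the new shape, and \<open>lam (Suc r) <= mu r\<close> makes the cell above any cell
  an old one, so no column receives two new entries.\<close>

lemma extend_tableau_in_SST:
  assumes mu: "mu \<in> supported_box {1..n} (\<lambda>i. {lam (Suc i)..lam i})" and T: "T \<in> SST mu n"
  shows "extend_tableau lam n mu T \<in> SST lam (Suc n)"
proof -
  let ?E = "extend_tableau lam n mu T"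
  have bounds: "lam (Suc r) \<le> mu r" "mu r \<le> lam r" if "1 \<le> r" "r \<le> n" for r
    using mu that by (auto simp: supported_box_def)
  have sub: "x \<in> yd_cells lam (Suc n)" if "x \<in> yd_cells mu n" for x
    using that by (auto simp: yd_cells_def intro: order_trans[OF _ bounds(2)])
  have small: "1 \<le> T x" "T x \<le> n" if "x \<in> yd_cells mu n" for x
    using T that by (auto simp: SST_def)
  have outside: "?E x = 0" if "x \<notin> yd_cells lam (Suc n)" for x
    using that sub[of x] by (auto simp: extend_tableau_def)
  have inside: "?E x \<in> {1..Suc n}" if "x \<in> yd_cells lam (Suc n)" for x
    using that small[of x] by (auto simp: extend_tableau_def)
  have rows: "?E (r, c) \<le> ?E (r, c + 1)"
    if cells: "(r, c) \<in> yd_cells lam (Suc n)" "(r, c + 1) \<in> yd_cells lam (Suc n)" for r c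
  proof (cases "(r, c + 1) \<in> yd_cells mu n")
    case True
    then have "(r, c) \<in> yd_cells mu n"
      using cells by (auto simp: yd_cells_def)
    then show ?thesis
      using True T by (simp add: extend_tableau_def SST_def)
  next
    case False
    then have "?E (r, c + 1) = Suc n"
      using cells by (simp add: extend_tableau_def)
    then show ?thesis
      using inside[OF cells(1)] by simp
  qed
  have cols: "?E (r, c) < ?E (r + 1, c)"
    if cells: "(r, c) \<in> yd_cells lam (Suc n)" "(r + 1, c) \<in> yd_cells lam (Suc n)" for r c
  proof -
    have r: "1 \<le> r" "r \<le> n"
      using cells by (auto simp: yd_cells_def)
    then have cell: "(r, c) \<in> yd_cells mu n"
      using cells bounds(1)[of r] by (auto simp: yd_cells_def)
    show ?thesis
    proof (cases "(r + 1, c) \<in> yd_cells mu n")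
      case True
      then show ?thesis
        using cell T by (simp add: extend_tableau_def SST_def)
    next
      case False
      then show ?thesis
        using cell cells small[OF cell] by (simp add: extend_tableau_def)
    qed
  qed
  show ?thesis
    unfolding SST_def using outside inside rows cols by blast
qed

text \<open>In each of the first \<open>n\<close> rows the entries at most \<open>n\<close> form an
  initial segment, as rows increase weakly. Its length defines \<open>mu\<close>.\<close>

lemma SST_Suc_obtain_extend_tableau:
  assumes T: "T \<in> SST lam (Suc n)" and dec: "\<And>i. 1 \<le> i \<Longrightarrow> i \<le> n \<Longrightarrow> lam (Suc i) \<le> lam i"
  obtains mu T' where "mu \<in> supported_box {1..n} (\<lambda>i. {lam (Suc i)..lam i})" "T' \<in> SST mu n"
    "T = extend_tableau lam n mu T'"
proof -
  have outside: "T x = 0" if "x \<notin> yd_cells lam (Suc n)" for x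
    using T that unfolding SST_def by blast
  have inside: "1 \<le> T x" "T x \<le> Suc n" if "x \<in> yd_cells lam (Suc n)" for x
    using T that by (auto simp: SST_def)
  have rows: "T (r, c) \<le> T (r, c + 1)"
    if "(r, c) \<in> yd_cells lam (Suc n)" "(r, c + 1) \<in> yd_cells lam (Suc n)" for r c
    using T that unfolding SST_def by blast
  have cols: "T (r, c) < T (r + 1, c)"
    if "(r, c) \<in> yd_cells lam (Suc n)" "(r + 1, c) \<in> yd_cells lam (Suc n)" for r c
    using T that unfolding SST_def by blast
  have "\<forall>r\<in>{1..n}. \<exists>m\<le>lam r. \<forall>c. 1 \<le> c \<and> c \<le> lam r \<longrightarrow> (T (r, c) \<le> n \<longleftrightarrow> c \<le> m)"
  proof
    fix r assume r: "r \<in> {1..n}"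
    show "\<exists>m\<le>lam r. \<forall>c. 1 \<le> c \<and> c \<le> lam r \<longrightarrow> (T (r, c) \<le> n \<longleftrightarrow> c \<le> m)"
    proof (rule downclosed_initial_segment)
      fix c assume "1 \<le> c" "c < lam r" "T (r, Suc c) \<le> n"
      then show "T (r, c) \<le> n"
        using rows[of r c] r by (auto simp: yd_cells_def)
    qed
  qed
  then obtain m where m: "\<And>r. r \<in> {1..n} \<Longrightarrow> m r \<le> lam r"
    "\<And>r c. r \<in> {1..n} \<Longrightarrow> 1 \<le> c \<Longrightarrow> c \<le> lam r \<Longrightarrow> T (r, c) \<le> n \<longleftrightarrow> c \<le> m r"
    by metis
  define mu where "mu = (\<lambda>r. if r \<in> {1..n} then m r else 0)"
  have mu_le: "mu r \<le> lam r" if "r \<in> {1..n}" for r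
    using m(1) that by (simp add: mu_def)
  have mu_iff: "T (r, c) \<le> n \<longleftrightarrow> c \<le> mu r" if "r \<in> {1..n}" "1 \<le> c" "c \<le> lam r" for r c
    using m(2) that by (simp add: mu_def)
  \<comment> \<open>Consider the last cell of row \<open>Suc r\<close>: the entry above it is
    strictly smaller, hence at most \<open>n\<close>, so \<open>mu r\<close> reaches that
    column.\<close>
  have lam_le: "lam (Suc r) \<le> mu r" if r: "r \<in> {1..n}" for r
  proof (cases "lam (Suc r) = 0")
    case False
    let ?c = "lam (Suc r)"
    have cells: "(r, ?c) \<in> yd_cells lam (Suc n)" "(r + 1, ?c) \<in> yd_cells lam (Suc n)"
      using False r dec[of r] by (auto simp: yd_cells_def)
    have "T (r, ?c) \<le> n"
      using cols[OF cells] inside(2)[OF cells(2)] by simp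
    then show ?thesis
      using mu_iff[of r ?c] r False dec[of r] by simp
  qed simp
  have mem: "mu \<in> supported_box {1..n} (\<lambda>i. {lam (Suc i)..lam i})"
    using mu_le lam_le by (auto simp: supported_box_def mu_def)
  have sub: "x \<in> yd_cells lam (Suc n)" if "x \<in> yd_cells mu n" for x
    using that by (auto simp: yd_cells_def intro: order_trans[OF _ mu_le])
  have le_n: "T (r, c) \<le> n" if "(r, c) \<in> yd_cells mu n" for r c
    using that mu_iff[of r c] mu_le[of r] by (auto simp: yd_cells_def)
  \<comment> \<open>In row \<open>Suc n\<close> the entry is at least its row index; in the other
    rows a cell beyond \<open>mu r\<close> has an entry exceeding \<open>n\<close> by the choice of
    \<open>mu\<close>.\<close>
  have eq_Suc_n: "T (r, c) = Suc n"
    if x: "(r, c) \<in> yd_cells lam (Suc n)" "(r, c) \<notin> yd_cells mu n" for r c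
  proof (cases "r = Suc n")
    case True
    then show ?thesis
      using SST_entry_ge_row[OF T _ x(1)] dec inside(2)[OF x(1)] by simp
  next
    case False
    then have "\<not> T (r, c) \<le> n"
      using x mu_iff[of r c] by (auto simp: yd_cells_def)
    then show ?thesis
      using inside(2)[OF x(1)] by simp
  qed
  define T' where "T' = (\<lambda>x. if x \<in> yd_cells mu n then T x else 0)"
  have "T' \<in> SST mu n"
    unfolding SST_def T'_def using inside(1)[OF sub] le_n rows[OF sub sub] cols[OF sub sub] by auto
  moreover have "T = extend_tableau lam n mu T'"
    using eq_Suc_n outside by (auto simp: extend_tableau_def T'_def fun_eq_iff)
  ultimately show thesis
    using that mem by blast
qed

text \<open>The smaller shape can be read off as the set of positions with entries in
  \<open>{1..n}\<close>: added cells hold \<open>Suc n\<close> and positions outside hold 0. Its row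
  lengths then determine \<open>mu\<close>.\<close>

lemma extend_tableau_inject:
  assumes mu: "mu \<in> supported_box {1..n} (\<lambda>i. {lam (Suc i)..lam i})" "T \<in> SST mu n"
    and mu': "mu' \<in> supported_box {1..n} (\<lambda>i. {lam (Suc i)..lam i})" "T' \<in> SST mu' n"
    and eq: "extend_tableau lam n mu T = extend_tableau lam n mu' T'"
  shows "mu = mu' \<and> T = T'"
proof -
  have cells_iff: "x \<in> yd_cells nu n \<longleftrightarrow> extend_tableau lam n nu S x \<in> {1..n}"
    if "S \<in> SST nu n" for nu S x
    using that by (auto simp: extend_tableau_def SST_def)
  have cells: "yd_cells mu n = yd_cells mu' n"
    using cells_iff[OF mu(2)] cells_iff[OF mu'(2)] eq by auto
  have "mu r = mu' r" for r
  proof (cases "r \<in> {1..n}")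
    case True
    then have "{1..mu r} = {1..mu' r}"
      using cells by (auto simp: yd_cells_def set_eq_iff)
    then show ?thesis
      by (metis card_atLeastAtMost diff_Suc_1)
  next
    case False
    then show ?thesis
      using mu(1) mu'(1) by (simp add: supported_box_def)
  qed
  moreover have "T x = T' x" for x
  proof (cases "x \<in> yd_cells mu n")
    case True
    then show ?thesis
      using fun_cong[OF eq, of x] cells by (simp add: extend_tableau_def)
  next
    case False
    then have "x \<notin> yd_cells mu' n"
      using cells by simp
    then have "T' x = 0"
      using mu'(2) unfolding SST_def by blast
    moreover have "T x = 0"
      using mu(2) False unfolding SST_def by blast
    ultimately show ?thesis by simp
  qed
  ultimately show ?thesis
    by auto
qed

lemma bij_betw_extend_tableau:
  assumes "\<And>i. 1 \<le> i \<Longrightarrow> i \<le> n \<Longrightarrow> lam (Suc i) \<le> lam i"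
  shows "bij_betw (\<lambda>(mu, T). extend_tableau lam n mu T)
     (SIGMA mu:supported_box {1..n} (\<lambda>i. {lam (Suc i)..lam i}). SST mu n) (SST lam (Suc n))"
  unfolding bij_betw_def
proof
  show "inj_on (\<lambda>(mu, T). extend_tableau lam n mu T)
     (SIGMA mu:supported_box {1..n} (\<lambda>i. {lam (Suc i)..lam i}). SST mu n)"
  proof (intro inj_onI, clarify)
    fix mu T mu' T'
    assume "mu \<in> supported_box {1..n} (\<lambda>i. {lam (Suc i)..lam i})" "T \<in> SST mu n"
      "mu' \<in> supported_box {1..n} (\<lambda>i. {lam (Suc i)..lam i})" "T' \<in> SST mu' n"
      "extend_tableau lam n mu T = extend_tableau lam n mu' T'"
    then show "mu = mu' \<and> T = T'"
      by (rule extend_tableau_inject)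
  qed
  show "(\<lambda>(mu, T). extend_tableau lam n mu T) `
     (SIGMA mu:supported_box {1..n} (\<lambda>i. {lam (Suc i)..lam i}). SST mu n) = SST lam (Suc n)"
  proof
    show "SST lam (Suc n) \<subseteq> (\<lambda>(mu, T). extend_tableau lam n mu T) `
       (SIGMA mu:supported_box {1..n} (\<lambda>i. {lam (Suc i)..lam i}). SST mu n)"
    proof
      fix T assume "T \<in> SST lam (Suc n)"
      then obtain mu T' where "mu \<in> supported_box {1..n} (\<lambda>i. {lam (Suc i)..lam i})"
        "T' \<in> SST mu n" "T = extend_tableau lam n mu T'"
        using SST_Suc_obtain_extend_tableau assms by blast
      then show "T \<in> (\<lambda>(mu, T). extend_tableau lam n mu T) `
         (SIGMA mu:supported_box {1..n} (\<lambda>i. {lam (Suc i)..lam i}). SST mu n)"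
        by force
    qed
  qed (auto intro: extend_tableau_in_SST)
qed

section \<open>Counting tableaux by the determinant\<close>

lemma card_SST_eq_binomial_det:
  assumes "\<And>i. 1 \<le> i \<Longrightarrow> i < n \<Longrightarrow> lam (Suc i) \<le> lam i"
  shows "finite (SST lam n)"
    and "real (card (SST lam n)) = binomial_det n (\<lambda>i. real i - real (lam i))"
proof -
  \<comment> \<open>Finiteness is carried through the induction because the cardinality of the
    disjoint union over \<open>mu\<close> becomes a sum only for finite fibres.\<close>
  have "finite (SST lam n) \<and> real (card (SST lam n)) = binomial_det n (\<lambda>i. real i - real (lam i))"
    using assms
  proof (induction n arbitrary: lam)
    case 0
    have "SST lam 0 = {\<lambda>_. 0}"
      by (auto simp: SST_def yd_cells_def)
    then show ?case
      by (simp add: binomial_det_def)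
  next
    case (Suc n)
    let ?I = "supported_box {1..n} (\<lambda>i. {lam (Suc i)..lam i})"
    have dec: "lam (Suc i) \<le> lam i" if "1 \<le> i" "i \<le> n" for i
      using Suc.prems that by simp
    have IH: "finite (SST mu n)"
      "real (card (SST mu n)) = binomial_det n (\<lambda>i. real i - real (mu i))" if "mu \<in> ?I" for mu
    proof -
      \<comment> \<open>Interlacing makes \<open>mu\<close> weakly decreasing, via
        \<open>lam (Suc i)\<close> in between, so the induction hypothesis applies to it.\<close>
      have "mu (Suc i) \<le> mu i" if "1 \<le> i" "i < n" for i
      proof -
        have "mu (Suc i) \<le> lam (Suc i)" "lam (Suc i) \<le> mu i"
          using \<open>mu \<in> ?I\<close> that by (auto simp: supported_box_def)
        then show ?thesis by simp
      qed
      then show "finite (SST mu n)"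
        "real (card (SST mu n)) = binomial_det n (\<lambda>i. real i - real (mu i))"
        using Suc.IH[of mu] by auto
    qed
    have fin: "finite ?I"
      by (rule finite_supported_box) auto
    have bij: "bij_betw (\<lambda>(mu, T). extend_tableau lam n mu T) (SIGMA mu:?I. SST mu n) (SST lam (Suc n))"
      by (rule bij_betw_extend_tableau) (rule dec)
    have "finite (SIGMA mu:?I. SST mu n)"
      using fin IH(1) by (rule finite_SigmaI)
    then have "finite (SST lam (Suc n))"
      using bij_betw_finite[OF bij] by simp
    moreover have "card (SST lam (Suc n)) = (\<Sum>mu\<in>?I. card (SST mu n))"
      using bij_betw_same_card[OF bij] card_SigmaI[OF fin, of "\<lambda>mu. SST mu n"] IH(1) by simp
    then have "real (card (SST lam (Suc n))) = binomial_det (Suc n) (\<lambda>i. real i - real (lam i))"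
      using IH(2) binomial_det_interlacing[of n lam] dec by simp
    ultimately show ?case ..
  qed
  then show "finite (SST lam n)"
    "real (card (SST lam n)) = binomial_det n (\<lambda>i. real i - real (lam i))"
    by blast+
qed

section \<open>Evaluation of Holman's series\<close>

theorem theorem3p9:
  fixes n :: nat and lam :: "nat \<Rightarrow> nat"
  assumes "n \<ge> 1"
    and "\<forall>i j. 1 \<le> i \<and> i \<le> j \<and> j \<le> n \<longrightarrow> lam j \<le> lam i"
  shows "(holman_term lam n has_sum (1 / real (card (SST lam n))))
           {k :: nat \<Rightarrow> nat. \<forall>i. i \<notin> {1..n} \<longrightarrow> k i = 0}
       \<and> 1 / real (card (SST lam n)) =
           (\<Prod>(i, j)\<in>{(i, j). 1 \<le> i \<and> i < j \<and> j \<le> n}.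
              real (j - i) / Aij lam i j)"
proof -
  let ?P = "{(i, j). 1 \<le> i \<and> i < j \<and> j \<le> n}"
  let ?B = "supported_box {1..n} (\<lambda>i. {..i - 1})"
  define x where "x = (\<lambda>i. real i - real (lam i))"
  define w where "w = (\<lambda>k :: nat \<Rightarrow> nat.
    \<Prod>i\<in>{1..n}. pochhammer (- real (i - 1)) (k i) / pochhammer 1 (k i))"
  have Aij: "Aij lam i j = x j - x i" for i j
    by (simp add: Aij_def x_def)
  have card: "real (card (SST lam n)) = binomial_det n x"
    unfolding x_def by (rule card_SST_eq_binomial_det) (use assms(2) in auto)
  have product: "1 / real (card (SST lam n)) = (\<Prod>(i, j)\<in>?P. real (j - i) / Aij lam i j)"
    unfolding card binomial_det_eq_prod Aij inverse_eq_divide[symmetric] prod_inversef[symmetric]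
    by (intro prod.cong) auto
  \<comment> \<open>Replacing \<open>x\<close> by \<open>x - k\<close> changes
    \<open>Aij lam i j\<close> into the numerator, and the factors \<open>j - i\<close> cancel. The
    Vandermonde part of the summand is thus a quotient of two binomial determinants, the lower one
    being the tableau count.\<close>
  have ratio: "(\<Prod>(i, j)\<in>?P. (Aij lam i j + real (k i) - real (k j)) / Aij lam i j)
      = binomial_det n (\<lambda>i. x i - real (k i)) / real (card (SST lam n))" for k
    unfolding card binomial_det_eq_prod prod_dividef[symmetric] Aij
  proof (intro prod.cong refl, clarify)
    fix i j :: nat assume "1 \<le> i" "i < j" "j \<le> n"
    then have "real (j - i) \<noteq> 0" by simp
    moreover have "x j - x i + real (k i) - real (k j) = x j - real (k j) - (x i - real (k i))"
      by simp
    ultimately show "(x j - x i + real (k i) - real (k j)) / (x j - x i)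
        = (x j - real (k j) - (x i - real (k i))) / real (j - i) / ((x j - x i) / real (j - i))"
      by (simp del: of_nat_diff)
  qed
  have "(holman_term lam n has_sum (1 / real (card (SST lam n)))) {k. \<forall>i. i \<notin> {1..n} \<longrightarrow> k i = 0}"
  \<comment> \<open>The series is a finite sum: off the box some \<open>k i\<close> exceeds
    \<open>i - 1\<close>, and then \<open>pochhammer (- real (i - 1)) (k i)\<close> contains the
    factor 0.\<close>
  proof (rule has_sum_finite_neutralI[where B = ?B])
    show "finite ?B"
      by (rule finite_supported_box) auto
    show "?B \<subseteq> {k. \<forall>i. i \<notin> {1..n} \<longrightarrow> k i = 0}"
      by (auto simp: supported_box_def)
    \<comment> \<open>The tableau count is a common denominator, and the weighted sum of
      determinants left above it equals 1.\<close>
    have "(\<Sum>k\<in>?B. holman_term lam n k)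
        = (\<Sum>k\<in>?B. w k * binomial_det n (\<lambda>i. x i - real (k i))) / real (card (SST lam n))"
      unfolding holman_term_def ratio w_def by (simp add: sum_divide_distrib mult.commute)
    then show "1 / real (card (SST lam n)) = (\<Sum>k\<in>?B. holman_term lam n k)"
      unfolding w_def sum_holman_binomial_det by simp
  next
    fix k assume k: "k \<in> {k. \<forall>i. i \<notin> {1..n} \<longrightarrow> k i = 0} - ?B"
    then obtain i where i: "i \<in> {1..n}" "i - 1 < k i"
      by (auto simp: supported_box_def not_le)
    have "pochhammer (- real (i - 1)) (k i) = 0"
      using i(2) by (rule pochhammer_of_nat_eq_0_lemma)
    then have "w k = 0"
      using i unfolding w_def by (intro prod_zero) auto
    then show "holman_term lam n k = 0"
      by (simp add: holman_term_def w_def)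
  qed
  then show ?thesis
    using product by blast
qed

end
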